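(* Let $D,n\ge 3$ be integers, let $x$ be a vertex of the Hamming graph $H(D,n)$, let $\Gamma=H(D,n)_f(x)$ be the full bipartite graph of $H(D,n)$ with respect to $x$, and let $A$ be the adjacency matrix of $\Gamma$. Let $A^*$ be the diagonal matrix with $(A^* )_{yy}=D(n-1)-n\,\partial(x,y)$ for every vertex $y$. For $0\le i\le 2D$ let $E_i$ be the primitive idempotent of $A$ corresponding to the eigenvalue $\theta_i=\sqrt{n-1}\,(D-i)$. Then $A^*$ is a dual adjacency matrix of $\Gamma$ with respect to $x$ and with respect to each of the following orderings of the primitive idempotents of $A$: (i) $E_0<E_2<\cdots<E_{2D}<E_1<E_3<\cdots<E_{2D-1}$; (ii) $E_1<E_3<\cdots<E_{2D-1}<E_0<E_2<\cdots<E_{2D}$.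
   Context: Hamming graph: let $S$ be a set with $n$ elements. $H(D,n)$ has vertex set $X=S^D$, and two vertices are adjacent iff they differ in precisely one coordinate. Let $\partial$ denote path-length distance in $H(D,n)$ (the Hamming distance). Full bipartite graph: given a connected graph with vertex set $X$, edge set $\mathcal{E}$, distance $\partial$, and a vertex $x$, its full bipartite graph with respect to $x$ is the graph $(X,\mathcal{E}_f)$ with $\mathcal{E}_f=\mathcal{E}\setminus\{yz \mid \partial(x,y)=\partial(x,z)\}$. (Distances from $x$ are the same in both graphs.) Matrices: $\mathrm{Mat}_X(\mathbb{R})$ is the algebra of real matrices with rows and columns indexed by $X$, acting on the space $V=\mathbb{R}^X$ of column vectors. Subalgebras generated by a matrix contain the identity matrix. $A\in \mathrm{Mat}_X(\mathbb{R})$ is the usual $0/1$ adjacency matrix of $\Gamma$. It is real symmetric, and its distinct eigenvalues are exactly $\theta_i=\sqrt{n-1}(D-i)$, $0\le i\le 2D$; $E_i$ is the projection of $V$ onto the $\theta_i$-eigenspace along the sum of the other eigenspaces. Dual adjacency algebra: for $0\le i\le D$ let $E_i^*\in \mathrm{Mat}_X(\mathbb{R})$ be the diagonal matrix whose $(y,y)$-entry is $1$ if $\partial(x,y)=i$ and $0$ otherwise. The dual adjacency algebra $M^*$ of $\Gamma$ with respect to $x$ is the span of $E_0^*,\dots,E_D^*$. Dual adjacency matrix: given an ordering $F_0<F_1<\cdots<F_{2D}$ of the primitive idempotents of $A$ (with $F_{-1}=F_{2D+1}=0$), a matrix $B\in \mathrm{Mat}_X(\mathbb{R})$ is a dual adjacency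 matrix of $\Gamma$ with respect to $x$ and this ordering if $B$ generates $M^*$ and $BF_iV\subseteq F_{i-1}V+F_iV+F_{i+1}V$ for $0\le i\le 2D$. *)

theory Defs
  imports "HOL-Analysis.Analysis"
begin

text \<open>A graph on the finite vertex type \<open>'v\<close> is given by its (symmetric, irreflexive)
  adjacency relation. Matrices with rows and columns indexed by the vertices have type
  \<open>real^'v^'v\<close>.\<close>

text \<open>A power \<open>E ^^ k\<close> relates the end points of walks of length \<open>k\<close>, so this is the
  path-length distance whenever \<open>y\<close> and \<open>z\<close> are connected; otherwise the value is unspecified.\<close>

definition graph_dist :: "('v \<Rightarrow> 'v \<Rightarrow> bool) \<Rightarrow> 'v \<Rightarrow> 'v \<Rightarrow> nat"
  where "graph_dist E y z = (LEAST k. (E ^^ k) y z)"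

definition full_bipartite_graph :: "('v \<Rightarrow> 'v \<Rightarrow> bool) \<Rightarrow> 'v \<Rightarrow> 'v \<Rightarrow> 'v \<Rightarrow> bool"
  where "full_bipartite_graph E x y z \<longleftrightarrow> E y z \<and> graph_dist E x y \<noteq> graph_dist E x z"

text \<open>The Hamming graph \<open>H(D,n)\<close> with \<open>D = CARD('d)\<close> and \<open>n = CARD('s)\<close>; its vertex set
  \<open>S\<^sup>D\<close> is the type \<open>'s^'d\<close>.\<close>

definition hamming_graph :: "('s::finite)^('d::finite) \<Rightarrow> 's^'d \<Rightarrow> bool"
  where "hamming_graph y z \<longleftrightarrow> card {c. y $ c \<noteq> z $ c} = 1"

definition adjacency_matrix :: "('v::finite \<Rightarrow> 'v \<Rightarrow> bool) \<Rightarrow> real^'v^'v"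
  where "adjacency_matrix E = (\<chi> y z. if E y z then 1 else 0)"

definition diagonal_matrix :: "('v::finite \<Rightarrow> real) \<Rightarrow> real^'v^'v"
  where "diagonal_matrix f = (\<chi> y z. if y = z then f y else 0)"

definition eigenspace :: "real^'v^'v \<Rightarrow> real \<Rightarrow> (real^'v::finite) set"
  where "eigenspace A \<theta> = {v. A *v v = \<theta> *\<^sub>R v}"

definition eigenvalues :: "real^'v^'v::finite \<Rightarrow> real set"
  where "eigenvalues A = {\<theta>. \<exists>v. v \<noteq> 0 \<and> A *v v = \<theta> *\<^sub>R v}"

text \<open>The projection onto the \<open>\<theta>\<close>-eigenspace along the sum of the other eigenspaces. It exists
  and is unique if \<open>A\<close> is diagonalizable over the reals, in particular if \<open>A\<close> is symmetric.\<close>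

definition primitive_idempotent :: "real^'v^'v::finite \<Rightarrow> real \<Rightarrow> real^'v^'v"
  where "primitive_idempotent A \<theta> =
    (THE P. (\<forall>v \<in> eigenspace A \<theta>. P *v v = v) \<and>
            (\<forall>v \<in> span (\<Union>\<mu> \<in> - {\<theta>}. eigenspace A \<mu>). P *v v = 0))"

definition primitive_idempotents :: "real^'v^'v::finite \<Rightarrow> (real^'v^'v) set"
  where "primitive_idempotents A = primitive_idempotent A ` eigenvalues A"

definition is_subalgebra :: "(real^'v^'v::finite) set \<Rightarrow> bool"
  where "is_subalgebra M \<longleftrightarrow>
    subspace M \<and> mat 1 \<in> M \<and> (\<forall>P \<in> M. \<forall>Q \<in> M. P ** Q \<in> M)"

definition generated_subalgebra :: "real^'v^'v::finite \<Rightarrow> (real^'v^'v) set"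
  where "generated_subalgebra B = is_subalgebra hull {B}"

definition dual_primitive_idempotent ::
    "('v::finite \<Rightarrow> 'v \<Rightarrow> bool) \<Rightarrow> 'v \<Rightarrow> nat \<Rightarrow> real^'v^'v"
  where "dual_primitive_idempotent E x i =
    diagonal_matrix (\<lambda>y. if graph_dist E x y = i then 1 else 0)"

definition dual_adjacency_algebra ::
    "('v::finite \<Rightarrow> 'v \<Rightarrow> bool) \<Rightarrow> 'v \<Rightarrow> nat \<Rightarrow> (real^'v^'v) set"
  where "dual_adjacency_algebra E x D = span (dual_primitive_idempotent E x ` {0..D})"

text \<open>An ordering \<open>F\<^sub>0 < F\<^sub>1 < \<dots>\<close> of the primitive idempotents is a list that enumerates them
  without repetition. Outside the index range, \<open>idempotent_at\<close> is the zero matrix.\<close>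

definition is_idempotent_ordering :: "real^'v^'v::finite \<Rightarrow> (real^'v^'v) list \<Rightarrow> bool"
  where "is_idempotent_ordering A Fs \<longleftrightarrow> distinct Fs \<and> set Fs = primitive_idempotents A"

definition idempotent_at :: "(real^'v^'v::finite) list \<Rightarrow> int \<Rightarrow> real^'v^'v"
  where "idempotent_at Fs i = (if 0 \<le> i \<and> i < int (length Fs) then Fs ! nat i else 0)"

definition column_image :: "real^'v^'v::finite \<Rightarrow> (real^'v) set"
  where "column_image P = range (\<lambda>v. P *v v)"

text \<open>The sums of subspaces below are the elementwise sums of sets. The parameter \<open>D\<close> is the
  largest distance from \<open>x\<close>, that is, the dual primitive idempotents are indexed by \<open>0..D\<close>.\<close>

definition is_dual_adjacency_matrix ::
    "('v::finite \<Rightarrow> 'v \<Rightarrow> bool) \<Rightarrow> 'v \<Rightarrow> nat \<Rightarrow> (real^'v^'v) list \<Rightarrow> real^'v^'v \<Rightarrow> bool"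
  where "is_dual_adjacency_matrix E x D Fs B \<longleftrightarrow>
    is_idempotent_ordering (adjacency_matrix E) Fs \<and>
    generated_subalgebra B = dual_adjacency_algebra E x D \<and>
    (\<forall>i \<in> {0..<int (length Fs)}.
       (\<lambda>v. B *v v) ` column_image (idempotent_at Fs i) \<subseteq>
         column_image (idempotent_at Fs (i - 1)) + column_image (idempotent_at Fs i)
         + column_image (idempotent_at Fs (i + 1)))"

end

theory Submission
  imports Defs
begin

text \<open>In the full bipartite graph of \<open>H(D,n)\<close>, two vertices are adjacent iff they differ in
  one coordinate \<open>c\<close> and exactly one of them has the entry \<open>x\<^sub>c\<close> there. So the graph is the
  Cartesian product of \<open>D\<close> stars \<open>K\<^bsub>1,n-1\<^esub>\<close>, the star of coordinate \<open>c\<close> having the centre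
  \<open>x\<^sub>c\<close>, and \<open>A\<close> is the sum of the star operators acting on the single coordinates. With
  \<open>s = sqrt (n - 1)\<close>, a star has the eigenvalues \<open>s\<close>, \<open>0\<close> and \<open>-s\<close>, and its eigenfunctions span
  all functions. A product of eigenfunctions for the eigenvalues \<open>s k\<^sub>c\<close>, where \<open>k\<^sub>c\<close> is
  \<open>-1\<close>, \<open>0\<close> or \<open>1\<close>, is an eigenvector of \<open>A\<close> for \<open>s \<kappa>\<close> with \<open>\<kappa> = \<Sum>\<^sub>c k\<^sub>c\<close>. These product
  vectors span the whole space (\<open>span_product_eigenvectors\<close>) and realize every
  \<open>\<kappa>\<close> from \<open>-D\<close> to \<open>D\<close> (\<open>product_eigenvectors_nonzero\<close>). Hence \<open>A\<close> is diagonalizable,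
  its spectrum is \<open>{\<theta>\<^sub>0, \<dots>, \<theta>\<^bsub>2D\<^esub>}\<close>, and \<open>E\<^sub>i\<close> has the \<open>\<theta>\<^sub>i\<close>-eigenspace as its image.

  The distance from \<open>x\<close> is \<open>\<partial>(x,y) = \<Sum>\<^sub>c (1 + \<epsilon>\<^sub>c(y)) / 2\<close>, where \<open>\<epsilon>\<^sub>c(y)\<close> is \<open>-1\<close> if
  \<open>y\<^sub>c = x\<^sub>c\<close> and \<open>1\<close> otherwise. A star is bipartite with its centre as one of the two parts, so
  changing the sign at the centre turns an eigenfunction for \<open>s k\<close> into one for \<open>-s k\<close>.
  Multiplication by \<open>\<epsilon>\<^sub>c\<close> therefore maps a product eigenvector for \<open>\<kappa>\<close> to one for
  \<open>\<kappa> - 2 k\<^sub>c\<close>, and \<open>A\<^sup>*\<close>, an affine function of the distance, maps the \<open>\<theta>\<^sub>i\<close>-eigenspace into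
  the sum of those for \<open>\<theta>\<^bsub>i-2\<^esub>\<close>, \<open>\<theta>\<^sub>i\<close> and \<open>\<theta>\<^bsub>i+2\<^esub>\<close> (\<open>dual_adjacency_on_eigenspace\<close>).
  Both orderings place \<open>i - 2\<close> just before and \<open>i + 2\<close> just after \<open>i\<close>, whenever these indices
  lie between \<open>0\<close> and \<open>2D\<close>.

  Finally, \<open>A\<^sup>*\<close> takes different values at different distances from \<open>x\<close>, so Lagrange
  interpolation writes each \<open>E\<^sub>i\<^sup>*\<close> as a polynomial in \<open>A\<^sup>*\<close>, and \<open>A\<^sup>*\<close> generates \<open>M\<^sup>*\<close>
  (\<open>generated_subalgebra_radial_diagonal\<close>).\<close>

section \<open>Spectral projections of a diagonalizable matrix\<close>

lemma is_subalgebra_generated: "is_subalgebra (generated_subalgebra B)"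
  unfolding generated_subalgebra_def
proof (rule hull_in)
  fix T :: "(real^'v^'v::finite) set set"
  assume "Ball T is_subalgebra"
  then show "is_subalgebra (\<Inter>T)"
    by (auto simp: is_subalgebra_def intro!: subspace_Inter)
qed

lemma generator_in_generated_subalgebra: "B \<in> generated_subalgebra B"
  unfolding generated_subalgebra_def by (rule hull_inc) simp

lemma subspace_eigenspace: "subspace (eigenspace A \<theta>)"
  by (auto simp: subspace_def eigenspace_def matrix_vector_right_distrib
      matrix_vector_mult_scaleR scaleR_add_right)

text \<open>The matrix is the product of the \<open>A - \<nu> I\<close> over \<open>\<nu> \<in> S\<close>.\<close>

lemma generated_subalgebra_separates_eigenvalues:
  fixes A :: "real^'v^'v::finite"
  assumes "finite S"
  shows "\<exists>P \<in> generated_subalgebra A. \<forall>\<mu>. \<forall>v \<in> eigenspace A \<mu>. P *v v = (\<Prod>\<nu>\<in>S. \<mu> - \<nu>) *\<^sub>R v"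
  using assms
proof (induction S)
  case empty
  have "mat 1 \<in> generated_subalgebra A"
    using is_subalgebra_generated[of A] by (simp add: is_subalgebra_def)
  then show ?case by (intro bexI[of _ "mat 1"]) auto
next
  case (insert \<nu> S)
  note sub = is_subalgebra_generated[of A, unfolded is_subalgebra_def]
  obtain P where P: "P \<in> generated_subalgebra A"
    "\<And>\<mu> v. v \<in> eigenspace A \<mu> \<Longrightarrow> P *v v = (\<Prod>\<nu>\<in>S. \<mu> - \<nu>) *\<^sub>R v"
    using insert.IH by blast
  have "A - \<nu> *\<^sub>R mat 1 \<in> generated_subalgebra A"
    using sub generator_in_generated_subalgebra by (blast intro: subspace_diff subspace_scale)
  then have "P ** (A - \<nu> *\<^sub>R mat 1) \<in> generated_subalgebra A"
    using sub P(1) by blast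
  moreover have "(P ** (A - \<nu> *\<^sub>R mat 1)) *v v = (\<Prod>\<nu>\<in>insert \<nu> S. \<mu> - \<nu>) *\<^sub>R v"
    if "v \<in> eigenspace A \<mu>" for \<mu> v
  proof -
    have "(A - \<nu> *\<^sub>R mat 1) *v v = (\<mu> - \<nu>) *\<^sub>R v"
      using that by (simp add: eigenspace_def matrix_vector_mult_diff_rdistrib
          scaleR_matrix_vector_assoc[symmetric] scaleR_diff_left)
    then show ?thesis
      using insert.hyps P(2)[OF that]
      by (simp add: matrix_vector_mul_assoc[symmetric] matrix_vector_mult_scaleR)
  qed
  ultimately show ?case by blast
qed

text \<open>A Lagrange polynomial in \<open>A\<close> has the defining properties of the projection onto an eigenspace.
  That it lies in the algebra generated by \<open>A\<close> gives the generators of the dual adjacency algebra;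
  its action on eigenvectors gives the existence of the primitive idempotents.\<close>

lemma interpolating_projection:
  fixes A :: "real^'v^'v::finite"
  assumes "finite S" "\<theta> \<notin> S"
  obtains P where "P \<in> generated_subalgebra A"
    "\<And>v. v \<in> eigenspace A \<theta> \<Longrightarrow> P *v v = v"
    "\<And>\<mu> v. \<mu> \<in> S \<Longrightarrow> v \<in> eigenspace A \<mu> \<Longrightarrow> P *v v = 0"
proof -
  obtain P where P: "P \<in> generated_subalgebra A"
    "\<And>\<mu> v. v \<in> eigenspace A \<mu> \<Longrightarrow> P *v v = (\<Prod>\<nu>\<in>S. \<mu> - \<nu>) *\<^sub>R v"
    using generated_subalgebra_separates_eigenvalues[OF assms(1)] by blast
  let ?p = "\<Prod>\<nu>\<in>S. \<theta> - \<nu>"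
  have p: "?p \<noteq> 0" using assms by auto
  show thesis
  proof (rule that[of "inverse ?p *\<^sub>R P"])
    show "inverse ?p *\<^sub>R P \<in> generated_subalgebra A"
      using is_subalgebra_generated[of A] P(1) by (simp add: is_subalgebra_def subspace_scale)
    show "(inverse ?p *\<^sub>R P) *v v = v" if "v \<in> eigenspace A \<theta>" for v
      using P(2)[OF that] p by (simp add: scaleR_matrix_vector_assoc[symmetric])
    show "(inverse ?p *\<^sub>R P) *v v = 0" if "\<mu> \<in> S" "v \<in> eigenspace A \<mu>" for \<mu> v
    proof -
      have "(\<Prod>\<nu>\<in>S. \<mu> - \<nu>) = 0" using that(1) assms(1) by auto
      then show ?thesis
        using P(2)[OF that(2)] by (simp add: scaleR_matrix_vector_assoc[symmetric])
    qed
  qed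
qed

lemma subspace_kernel_matrix: "subspace {v. (P :: real^'v^'v::finite) *v v = 0}"
  by (auto simp: subspace_def matrix_vector_right_distrib matrix_vector_mult_scaleR)

text \<open>The polynomial that is \<open>1\<close> at \<open>\<theta>\<close> and vanishes on \<open>\<Theta>\<close> annihilates every vector if the
  eigenspaces for \<open>\<Theta>\<close> span, but fixes the eigenvectors for \<open>\<theta>\<close>.\<close>

lemma eigenspace_trivial:
  fixes A :: "real^'v^'v::finite"
  assumes "finite \<Theta>" and span: "span (\<Union>\<theta>\<in>\<Theta>. eigenspace A \<theta>) = UNIV" and "\<theta> \<notin> \<Theta>"
  shows "eigenspace A \<theta> = {0}"
proof -
  obtain P where P: "\<And>v. v \<in> eigenspace A \<theta> \<Longrightarrow> P *v v = v"
    "\<And>\<mu> v. \<mu> \<in> \<Theta> \<Longrightarrow> v \<in> eigenspace A \<mu> \<Longrightarrow> P *v v = 0"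
    using interpolating_projection[OF assms(1,3)] by metis
  have "span (\<Union>\<theta>\<in>\<Theta>. eigenspace A \<theta>) \<subseteq> {v. P *v v = 0}"
    using P(2) by (intro span_minimal subspace_kernel_matrix) auto
  then have "P *v v = 0" for v using span by auto
  then show ?thesis
    using P(1) subspace_0[OF subspace_eigenspace] by fastforce
qed

text \<open>For a diagonalizable matrix, the description that defines the primitive idempotent is satisfied
  by an interpolation polynomial and, as the eigenvectors span, by no other matrix.\<close>

lemma primitive_idempotent_mult:
  fixes A :: "real^'v^'v::finite"
  assumes "finite \<Theta>" and span: "span (\<Union>\<theta>\<in>\<Theta>. eigenspace A \<theta>) = UNIV"
  shows "v \<in> eigenspace A \<mu> \<Longrightarrow>
    primitive_idempotent A \<theta> *v v = (if \<mu> = \<theta> then v else 0)"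
proof -
  let ?isproj = "\<lambda>P. (\<forall>v \<in> eigenspace A \<theta>. P *v v = v) \<and>
            (\<forall>v \<in> span (\<Union>\<mu> \<in> - {\<theta>}. eigenspace A \<mu>). P *v v = 0)"
  obtain P where P: "\<And>v. v \<in> eigenspace A \<theta> \<Longrightarrow> P *v v = v"
    "\<And>\<mu> v. \<mu> \<in> \<Theta> - {\<theta>} \<Longrightarrow> v \<in> eigenspace A \<mu> \<Longrightarrow> P *v v = 0"
    using interpolating_projection[of "\<Theta> - {\<theta>}" \<theta> A] assms(1) by (metis DiffE finite_Diff insertI1)
  have "P *v v = 0" if "\<mu> \<noteq> \<theta>" "v \<in> eigenspace A \<mu>" for \<mu> v
    using P(2)[of \<mu> v] eigenspace_trivial[OF assms, of \<mu>] that by (cases "\<mu> \<in> \<Theta>") auto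
  then have "span (\<Union>\<mu> \<in> - {\<theta>}. eigenspace A \<mu>) \<subseteq> {v. P *v v = 0}"
    by (intro span_minimal subspace_kernel_matrix) auto
  then have "?isproj P" using P(1) by auto
  moreover have "P' = P" if P': "?isproj P'" for P'
  proof -
    have "span (\<Union>\<theta>\<in>\<Theta>. eigenspace A \<theta>) \<subseteq> {v. (P' - P) *v v = 0}"
    proof (intro span_minimal subspace_kernel_matrix subsetI)
      fix v assume "v \<in> (\<Union>\<theta>\<in>\<Theta>. eigenspace A \<theta>)"
      then obtain \<mu> where "v \<in> eigenspace A \<mu>" by blast
      then have "v \<in> eigenspace A \<theta> \<or> v \<in> span (\<Union>\<mu> \<in> - {\<theta>}. eigenspace A \<mu>)"
        by (cases "\<mu> = \<theta>") (auto intro!: span_base)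
      then show "v \<in> {v. (P' - P) *v v = 0}"
        using P' \<open>?isproj P\<close> by (auto simp: matrix_vector_mult_diff_rdistrib)
    qed
    then have "P' *v v = P *v v" for v
      using span by (auto simp: matrix_vector_mult_diff_rdistrib)
    then show ?thesis by (simp add: matrix_eq)
  qed
  ultimately have "?isproj (primitive_idempotent A \<theta>)"
    unfolding primitive_idempotent_def by (rule theI[where P = ?isproj])
  then show "v \<in> eigenspace A \<mu> \<Longrightarrow>
    primitive_idempotent A \<theta> *v v = (if \<mu> = \<theta> then v else 0)"
    by (auto intro!: span_base)
qed

lemma column_image_primitive_idempotent:
  fixes A :: "real^'v^'v::finite"
  assumes "finite \<Theta>" and span: "span (\<Union>\<theta>\<in>\<Theta>. eigenspace A \<theta>) = UNIV"
  shows "column_image (primitive_idempotent A \<theta>) = eigenspace A \<theta>"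
proof
  let ?P = "primitive_idempotent A \<theta>"
  have "span (\<Union>\<theta>\<in>\<Theta>. eigenspace A \<theta>) \<subseteq> {v. ?P *v v \<in> eigenspace A \<theta>}"
  proof (intro span_minimal subsetI)
    show "subspace {v. ?P *v v \<in> eigenspace A \<theta>}"
      using subspace_eigenspace[of A \<theta>]
      by (auto simp: subspace_def matrix_vector_right_distrib matrix_vector_mult_scaleR)
    show "v \<in> {v. ?P *v v \<in> eigenspace A \<theta>}" if "v \<in> (\<Union>\<theta>\<in>\<Theta>. eigenspace A \<theta>)" for v
      using that primitive_idempotent_mult[OF assms] subspace_0[OF subspace_eigenspace[of A \<theta>]]
      by force
  qed
  then show "column_image ?P \<subseteq> eigenspace A \<theta>"
    using span by (auto simp: column_image_def)
  show "eigenspace A \<theta> \<subseteq> column_image ?P"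
    using primitive_idempotent_mult[OF assms, of _ \<theta> \<theta>] unfolding column_image_def
    by (metis rangeI subsetI)
qed

lemma inj_on_primitive_idempotent:
  fixes A :: "real^'v^'v::finite"
  assumes "finite \<Theta>" and span: "span (\<Union>\<theta>\<in>\<Theta>. eigenspace A \<theta>) = UNIV"
  shows "inj_on (primitive_idempotent A) (eigenvalues A)"
proof (rule inj_onI)
  fix \<theta> \<mu> assume "\<theta> \<in> eigenvalues A" and eq: "primitive_idempotent A \<theta> = primitive_idempotent A \<mu>"
  then obtain v where v: "v \<noteq> 0" "v \<in> eigenspace A \<theta>"
    by (auto simp: eigenvalues_def eigenspace_def)
  show "\<theta> = \<mu>"
    using primitive_idempotent_mult[OF assms v(2), of \<theta>]
      primitive_idempotent_mult[OF assms v(2), of \<mu>] v(1) eq by (auto split: if_splits)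
qed

section \<open>The dual adjacency algebra\<close>

lemma diagonal_matrix_mult_vector: "(diagonal_matrix f *v v) $ y = f y * v $ y"
  by (simp add: diagonal_matrix_def matrix_vector_mult_def if_distrib[of "\<lambda>a. a * _"] cong: if_cong)

lemma diagonal_matrix_mult:
  "diagonal_matrix f ** diagonal_matrix g = diagonal_matrix (\<lambda>y. f y * g y)"
  by (simp add: matrix_eq vec_eq_iff matrix_vector_mul_assoc[symmetric]
      diagonal_matrix_mult_vector mult.assoc)

lemma dual_adjacency_algebra_eq:
  assumes "\<And>y. graph_dist E x y \<le> D"
  shows "dual_adjacency_algebra E x D = range (\<lambda>h. diagonal_matrix (\<lambda>y. h (graph_dist E x y)))"
    (is "_ = ?M")
proof
  have M: "P \<in> ?M" if "P = diagonal_matrix (\<lambda>y. h (graph_dist E x y))" for P h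
    using that by auto
  have "subspace ?M"
    unfolding subspace_def
  proof (intro conjI ballI allI)
    show "0 \<in> ?M"
      by (rule M[of _ "\<lambda>_. 0"]) (simp add: diagonal_matrix_def vec_eq_iff)
    show "P + Q \<in> ?M" if PQ: "P \<in> ?M" "Q \<in> ?M" for P Q
    proof -
      obtain h k where "P = diagonal_matrix (\<lambda>y. h (graph_dist E x y))"
        "Q = diagonal_matrix (\<lambda>y. k (graph_dist E x y))"
        using PQ by blast
      then show ?thesis
        by (intro M[of _ "\<lambda>i. h i + k i"]) (simp add: diagonal_matrix_def vec_eq_iff)
    qed
    show "c *\<^sub>R P \<in> ?M" if P: "P \<in> ?M" for c P
    proof -
      obtain h where "P = diagonal_matrix (\<lambda>y. h (graph_dist E x y))"
        using P by blast
      then show ?thesis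
        by (intro M[of _ "\<lambda>i. c * h i"]) (simp add: diagonal_matrix_def vec_eq_iff)
    qed
  qed
  then show "dual_adjacency_algebra E x D \<subseteq> ?M"
    unfolding dual_adjacency_algebra_def
  proof (rule span_minimal[rotated])
    show "dual_primitive_idempotent E x ` {0..D} \<subseteq> ?M"
      unfolding dual_primitive_idempotent_def
      by (auto intro!: rangeI image_eqI[where x = "\<lambda>j. if j = _ then 1 else 0"])
  qed
  show "?M \<subseteq> dual_adjacency_algebra E x D"
  proof clarify
    fix h
    have "diagonal_matrix (\<lambda>y. h (graph_dist E x y)) =
        (\<Sum>i\<in>{0..D}. h i *\<^sub>R dual_primitive_idempotent E x i)"
      using assms by (auto simp: vec_eq_iff diagonal_matrix_def dual_primitive_idempotent_def
          if_distrib[of "\<lambda>a. _ * a"] cong: if_cong)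
    also have "\<dots> \<in> dual_adjacency_algebra E x D"
      unfolding dual_adjacency_algebra_def
      by (intro span_sum span_scale span_base) auto
    finally show "diagonal_matrix (\<lambda>y. h (graph_dist E x y)) \<in> dual_adjacency_algebra E x D" .
  qed
qed

text \<open>As \<open>g\<close> separates the distances, the polynomial that is \<open>1\<close> at \<open>g i\<close> and vanishes at the
  other values of \<open>g\<close> turns the diagonal matrix into the \<open>i\<close>-th dual primitive idempotent.\<close>

lemma generated_subalgebra_radial_diagonal:
  fixes E :: "'v::finite \<Rightarrow> 'v \<Rightarrow> bool"
  assumes dist: "\<And>y. graph_dist E x y \<le> D" and inj: "inj_on g {0..D}"
  shows "generated_subalgebra (diagonal_matrix (\<lambda>y. g (graph_dist E x y))) =
    dual_adjacency_algebra E x D" (is "generated_subalgebra ?B = ?M")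
proof
  note M = dual_adjacency_algebra_eq[of E x D, OF dist]
  have "is_subalgebra ?M"
    unfolding is_subalgebra_def
  proof (intro conjI ballI)
    show "subspace ?M" by (simp add: dual_adjacency_algebra_def)
    show "mat 1 \<in> ?M"
      unfolding M by (rule image_eqI[where x = "\<lambda>_. 1"]) (auto simp: diagonal_matrix_def mat_def)
    show "P ** Q \<in> ?M" if PQ: "P \<in> ?M" "Q \<in> ?M" for P Q
    proof -
      obtain h k where "P = diagonal_matrix (\<lambda>y. h (graph_dist E x y))"
        "Q = diagonal_matrix (\<lambda>y. k (graph_dist E x y))"
        using PQ M by blast
      then show ?thesis
        unfolding M by (intro image_eqI[where x = "\<lambda>i. h i * k i"]) (simp_all add: diagonal_matrix_mult)
    qed
  qed
  moreover have "?B \<in> ?M" unfolding M by blast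
  ultimately show "generated_subalgebra ?B \<subseteq> ?M"
    unfolding generated_subalgebra_def by (intro hull_minimal) auto
  have "dual_primitive_idempotent E x i \<in> generated_subalgebra ?B" if i: "i \<le> D" for i
  proof -
    have "g i \<notin> g ` ({0..D} - {i})"
      using inj i by (auto simp: inj_on_def)
    then obtain P where P: "P \<in> generated_subalgebra ?B"
      "\<And>v. v \<in> eigenspace ?B (g i) \<Longrightarrow> P *v v = v"
      "\<And>\<mu> v. \<mu> \<in> g ` ({0..D} - {i}) \<Longrightarrow> v \<in> eigenspace ?B \<mu> \<Longrightarrow> P *v v = 0"
      using interpolating_projection[of "g ` ({0..D} - {i})" "g i" ?B] by blast
    \<comment> \<open>The unit vectors are eigenvectors of a diagonal matrix, so they determine \<open>P\<close>.\<close>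
    have "P $ z $ y = dual_primitive_idempotent E x i $ z $ y" for y z
    proof -
      have "axis y 1 \<in> eigenspace ?B (g (graph_dist E x y))"
        by (auto simp: eigenspace_def vec_eq_iff diagonal_matrix_mult_vector axis_def)
      then have "P *v axis y 1 = (if graph_dist E x y = i then axis y 1 else 0)"
        using P(2)[of "axis y 1"] P(3)[of "g (graph_dist E x y)" "axis y 1"] dist[of y]
        by (cases "graph_dist E x y = i") auto
      moreover have "P $ z $ y = (P *v axis y 1) $ z"
        by (simp add: matrix_vector_mult_def axis_def if_distrib[of "\<lambda>a. _ * a"] cong: if_cong)
      ultimately show ?thesis
        by (simp add: dual_primitive_idempotent_def diagonal_matrix_def axis_def)
    qed
    then have "P = dual_primitive_idempotent E x i" by (simp add: vec_eq_iff)
    then show ?thesis using P(1) by simp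
  qed
  then show "?M \<subseteq> generated_subalgebra ?B"
    using is_subalgebra_generated[of ?B] unfolding dual_adjacency_algebra_def
    by (intro span_minimal) (auto simp: is_subalgebra_def)
qed

section \<open>Distances in the full bipartite graph\<close>

text \<open>A potential that grows by at most one along each edge bounds the distance from below; if one can
  always descend by one towards \<open>x\<close>, it is also attained. The criterion serves for the Hamming
  graph and for its full bipartite graph, with the same potential.\<close>

lemma graph_dist_eqI:
  fixes w :: "'v \<Rightarrow> nat"
  assumes "w x = 0" and zero: "\<And>y. w y = 0 \<Longrightarrow> y = x"
    and up: "\<And>y z. E y z \<Longrightarrow> w z \<le> Suc (w y)"
    and down: "\<And>y k. w y = Suc k \<Longrightarrow> \<exists>z. w z = k \<and> E z y"
  shows "graph_dist E x y = w y"
  unfolding graph_dist_def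
proof (rule Least_equality)
  show "(E ^^ w y) x y"
  proof (induction "w y" arbitrary: y)
    case 0
    then show ?case using zero[of y] assms(1) by simp
  next
    case (Suc k)
    then obtain z where "w z = k" "E z y" using down by metis
    then show ?case using Suc by (metis relpowp_Suc_I)
  qed
  show "w y \<le> k" if "(E ^^ k) x y" for k
    using that
  proof (induction k arbitrary: y)
    case 0
    then show ?case using assms(1) by simp
  next
    case (Suc k)
    then obtain z where "(E ^^ k) x z" "E z y" by (metis relpowp_Suc_E)
    then show ?case using Suc.IH[of z] up[of z y] by linarith
  qed
qed

definition hamming_dist :: "'s^'d \<Rightarrow> 's^'d::finite \<Rightarrow> nat"
  where "hamming_dist x y = card {c. y $ c \<noteq> x $ c}"

definition replace_coord :: "'s^'d \<Rightarrow> 'd::finite \<Rightarrow> 's \<Rightarrow> 's^'d"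
  where "replace_coord y c a = (\<chi> j. if j = c then a else y $ j)"

lemma replace_coord_nth [simp]: "replace_coord y c a $ j = (if j = c then a else y $ j)"
  by (simp add: replace_coord_def)

lemma hamming_graph_iff:
  "hamming_graph y z \<longleftrightarrow> (\<exists>c a. a \<noteq> y $ c \<and> z = replace_coord y c a)"
proof
  assume "hamming_graph y z"
  then obtain c where c: "{c. y $ c \<noteq> z $ c} = {c}"
    by (auto simp: hamming_graph_def card_1_singleton_iff)
  then have "y $ j \<noteq> z $ j \<longleftrightarrow> j = c" for j by blast
  then have "z $ c \<noteq> y $ c" "z = replace_coord y c (z $ c)"
    unfolding vec_eq_iff by (metis, metis replace_coord_nth)
  then show "\<exists>c a. a \<noteq> y $ c \<and> z = replace_coord y c a" by blast
next
  assume "\<exists>c a. a \<noteq> y $ c \<and> z = replace_coord y c a"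
  then obtain c a where "a \<noteq> y $ c" "z = replace_coord y c a" by blast
  then have "{c. y $ c \<noteq> z $ c} = {c}" by auto
  then show "hamming_graph y z" by (simp add: hamming_graph_def)
qed

text \<open>Stated as a balance without subtraction on the naturals, so that one equation covers a move
  between the centre and a leaf in either direction as well as a move from leaf to leaf.\<close>

lemma hamming_dist_replace_coord:
  "hamming_dist x (replace_coord y c a) + (if y $ c = x $ c then 0 else 1) =
   hamming_dist x y + (if a = x $ c then 0 else 1)"
proof -
  have w: "hamming_dist x z = card {j. j \<noteq> c \<and> z $ j \<noteq> x $ j} + (if z $ c = x $ c then 0 else 1)" for z
  proof (cases "z $ c = x $ c")
    case True
    then have "{j. z $ j \<noteq> x $ j} = {j. j \<noteq> c \<and> z $ j \<noteq> x $ j}" by auto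
    then show ?thesis using True by (simp add: hamming_dist_def)
  next
    case False
    then have "{j. z $ j \<noteq> x $ j} = insert c {j. j \<noteq> c \<and> z $ j \<noteq> x $ j}" by auto
    then show ?thesis using False by (simp add: hamming_dist_def)
  qed
  have "{j. j \<noteq> c \<and> replace_coord y c a $ j \<noteq> x $ j} = {j. j \<noteq> c \<and> y $ j \<noteq> x $ j}"
    by auto
  then show ?thesis using w[of "replace_coord y c a"] w[of y] by simp
qed

lemma hamming_dist_eq_0_iff: "hamming_dist x y = 0 \<longleftrightarrow> y = x"
  by (auto simp: hamming_dist_def vec_eq_iff)

lemma hamming_dist_decreasing_neighbour:
  assumes "hamming_dist x y = Suc k"
  shows "\<exists>z. hamming_dist x z = k \<and> hamming_graph z y"
proof -
  obtain c where c: "y $ c \<noteq> x $ c"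
    using assms hamming_dist_eq_0_iff[of x y] by (auto simp: vec_eq_iff)
  let ?z = "replace_coord y c (x $ c)"
  have "hamming_dist x ?z = k"
    using hamming_dist_replace_coord[of x y c "x $ c"] c assms by simp
  moreover have "hamming_graph ?z y"
    unfolding hamming_graph_iff
    using c by (intro exI[of _ c] exI[of _ "y $ c"]) (auto simp: vec_eq_iff)
  ultimately show ?thesis by blast
qed

lemma hamming_dist_adjacent_le: "hamming_graph y z \<Longrightarrow> hamming_dist x z \<le> Suc (hamming_dist x y)"
proof -
  assume "hamming_graph y z"
  then obtain c a where "z = replace_coord y c a" by (auto simp: hamming_graph_iff)
  then show ?thesis using hamming_dist_replace_coord[of x y c a] by (simp split: if_splits)
qed

lemma graph_dist_hamming: "graph_dist hamming_graph x y = hamming_dist x y"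
  by (rule graph_dist_eqI)
    (auto simp: hamming_dist_eq_0_iff hamming_dist_adjacent_le hamming_dist_decreasing_neighbour)

lemma graph_dist_full_bipartite:
  "graph_dist (full_bipartite_graph hamming_graph x) x y = hamming_dist x y"
proof (rule graph_dist_eqI)
  show "\<exists>z. hamming_dist x z = k \<and> full_bipartite_graph hamming_graph x z y" if "hamming_dist x y = Suc k" for y k
    using hamming_dist_decreasing_neighbour[OF that] that
    by (auto simp: full_bipartite_graph_def graph_dist_hamming)
qed (auto simp: hamming_dist_eq_0_iff hamming_dist_adjacent_le full_bipartite_graph_def)

text \<open>The edges are those of a Cartesian product of stars: one coordinate moves between the centre
  \<open>x\<^sub>c\<close> and a leaf.\<close>

lemma full_bipartite_hamming_iff:
  "full_bipartite_graph hamming_graph x y z \<longleftrightarrow>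
   (\<exists>c a. (a = x $ c) \<noteq> (y $ c = x $ c) \<and> z = replace_coord y c a)"
proof -
  have "hamming_dist x y \<noteq> hamming_dist x (replace_coord y c a) \<longleftrightarrow> (a = x $ c) \<noteq> (y $ c = x $ c)" for c a
    using hamming_dist_replace_coord[of x y c a] by (auto split: if_splits)
  then show ?thesis
    unfolding full_bipartite_graph_def graph_dist_hamming hamming_graph_iff by metis
qed

section \<open>Product eigenvectors\<close>

text \<open>The adjacency operator of the star on \<open>'s\<close> with centre \<open>p\<close>.\<close>

definition star_operator :: "'s::finite \<Rightarrow> ('s \<Rightarrow> real) \<Rightarrow> 's \<Rightarrow> real"
  where "star_operator p f b = (\<Sum>a | (a = p) \<noteq> (b = p). f a)"

lemma adjacency_matrix_mult_vector:
  fixes x :: "('s::finite)^('d::finite)"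
  shows "(adjacency_matrix (full_bipartite_graph hamming_graph x) *v v) $ y =
    (\<Sum>c\<in>UNIV. star_operator (x $ c) (\<lambda>a. v $ replace_coord y c a) (y $ c))"
proof -
  let ?\<Gamma> = "full_bipartite_graph hamming_graph x"
  let ?S = "SIGMA c:UNIV. {a. (a = x $ c) \<noteq> (y $ c = x $ c)}"
  have inj: "inj_on (\<lambda>(c, a). replace_coord y c a) ?S"
  proof (rule inj_onI, clarify)
    fix c a c' a'
    assume a: "(a = x $ c) \<noteq> (y $ c = x $ c)" "(a' = x $ c') \<noteq> (y $ c' = x $ c')"
      and "replace_coord y c a = replace_coord y c' a'"
    then have "replace_coord y c a $ c = replace_coord y c' a' $ c"
      "replace_coord y c a $ c' = replace_coord y c' a' $ c'"
      by simp_all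
    then show "c = c' \<and> a = a'" using a by (auto split: if_splits)
  qed
  have nbrs: "{z. ?\<Gamma> y z} = (\<lambda>(c, a). replace_coord y c a) ` ?S"
    unfolding full_bipartite_hamming_iff by (auto simp: image_iff)
  have "(adjacency_matrix ?\<Gamma> *v v) $ y = (\<Sum>z | ?\<Gamma> y z. v $ z)"
    by (simp add: adjacency_matrix_def matrix_vector_mult_def if_distrib[of "\<lambda>a. a * _"]
        sum.If_cases cong: if_cong)
  also have "\<dots> = (\<Sum>(c, a)\<in>?S. v $ replace_coord y c a)"
    unfolding nbrs by (subst sum.reindex[OF inj]) (simp add: case_prod_unfold)
  also have "\<dots> = (\<Sum>c\<in>UNIV. star_operator (x $ c) (\<lambda>a. v $ replace_coord y c a) (y $ c))"
    unfolding star_operator_def by (rule sum.Sigma[symmetric]) auto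
  finally show ?thesis .
qed

definition product_vector :: "('d \<Rightarrow> 's \<Rightarrow> real) \<Rightarrow> real^('s::finite^'d::finite)"
  where "product_vector f = (\<chi> y. \<Prod>c\<in>UNIV. f c (y $ c))"

lemma product_vector_replace_coord:
  "product_vector f $ replace_coord y c a = f c a * (\<Prod>j\<in>UNIV - {c}. f j (y $ j))"
proof -
  have "(\<Prod>j\<in>UNIV. f j (replace_coord y c a $ j)) =
      f c a * (\<Prod>j\<in>UNIV - {c}. f j (replace_coord y c a $ j))"
    by (subst prod.remove[of UNIV c]) auto
  also have "(\<Prod>j\<in>UNIV - {c}. f j (replace_coord y c a $ j)) = (\<Prod>j\<in>UNIV - {c}. f j (y $ j))"
    by (rule prod.cong) auto
  finally show ?thesis by (simp add: product_vector_def)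
qed

lemma product_vector_nth_remove:
  "product_vector f $ y = f c (y $ c) * (\<Prod>j\<in>UNIV - {c}. f j (y $ j))"
  unfolding product_vector_def by (subst prod.remove[of UNIV c]) auto

text \<open>The functions are indexed by the integer \<open>k\<close>, the eigenvalue divided by
  \<open>sqrt (CARD('s) - 1)\<close>, since only sums and signs of these integers matter later.\<close>

definition star_eigenfunctions :: "'s::finite \<Rightarrow> int \<Rightarrow> ('s \<Rightarrow> real) set"
  where "star_eigenfunctions p k =
    {f. \<forall>b. star_operator p f b = sqrt (real CARD('s) - 1) * of_int k * f b}"

definition product_eigenvectors ::
    "('s::finite)^('d::finite) \<Rightarrow> int \<Rightarrow> (real^('s^'d)) set"
  where "product_eigenvectors x \<kappa> = {product_vector f | f k.
    (\<forall>c. f c \<in> star_eigenfunctions (x $ c) (k c) \<and> k c \<in> {-1, 0, 1}) \<and> (\<Sum>c\<in>UNIV. k c) = \<kappa>}"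

lemma product_eigenvectors_subset_eigenspace:
  fixes x :: "('s::finite)^('d::finite)"
  shows "product_eigenvectors x \<kappa> \<subseteq>
    eigenspace (adjacency_matrix (full_bipartite_graph hamming_graph x))
      (sqrt (real CARD('s) - 1) * of_int \<kappa>)"
proof
  let ?A = "adjacency_matrix (full_bipartite_graph hamming_graph x)"
  let ?s = "sqrt (real CARD('s) - 1)"
  fix v assume "v \<in> product_eigenvectors x \<kappa>"
  then obtain f k where v: "v = product_vector f" and \<kappa>: "(\<Sum>c\<in>UNIV. k c) = \<kappa>"
    and f: "\<And>c. f c \<in> star_eigenfunctions (x $ c) (k c)"
    unfolding product_eigenvectors_def by blast
  have "(?A *v v) $ y = (?s * of_int \<kappa>) * v $ y" for y
  proof -
    have "(?A *v v) $ y = (\<Sum>c\<in>UNIV. star_operator (x $ c) (f c) (y $ c) *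
        (\<Prod>j\<in>UNIV - {c}. f j (y $ j)))"
      unfolding adjacency_matrix_mult_vector v product_vector_replace_coord star_operator_def
      by (simp add: sum_distrib_right)
    also have "\<dots> = (\<Sum>c\<in>UNIV. ?s * of_int (k c) * v $ y)"
    proof (rule sum.cong)
      fix c
      show "star_operator (x $ c) (f c) (y $ c) * (\<Prod>j\<in>UNIV - {c}. f j (y $ j)) =
          ?s * of_int (k c) * v $ y"
        using f[of c] unfolding v product_vector_nth_remove[of f y c]
        by (simp add: star_eigenfunctions_def)
    qed simp
    also have "\<dots> = (?s * of_int \<kappa>) * v $ y"
      by (simp add: \<kappa>[symmetric] sum_distrib_left sum_distrib_right)
    finally show ?thesis .
  qed
  then show "v \<in> eigenspace ?A (?s * of_int \<kappa>)"
    by (simp add: eigenspace_def vec_eq_iff)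
qed

lemma star_operator_eq:
  "star_operator p f b = (if b = p then (\<Sum>a\<in>UNIV. f a) - f p else f p)"
proof -
  have "{a. a \<noteq> p} = UNIV - {p}" by auto
  then show ?thesis by (simp add: star_operator_def sum_diff1)
qed

lemma sum_plus_indicator:
  fixes \<alpha> \<beta> :: real and p :: "'s::finite"
  shows "(\<Sum>a\<in>UNIV. if a = p then \<alpha> else \<beta>) = \<alpha> + (real CARD('s) - 1) * \<beta>"
proof -
  have "(\<Sum>a\<in>UNIV. if a = p then \<alpha> else \<beta>) = \<alpha> + (\<Sum>a\<in>UNIV - {p}. \<beta>)"
    by (subst sum.remove[of UNIV p]) auto
  also have "(\<Sum>a\<in>UNIV - {p}. \<beta>) = (real CARD('s) - 1) * \<beta>"
    by (simp add: card_Diff_singleton of_nat_diff Suc_leI)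
  finally show ?thesis .
qed

text \<open>Besides these two, a star has the functions that vanish at the centre and have sum zero on
  the leaves, with eigenvalue \<open>0\<close>.\<close>

lemma star_eigenfunction_sign:
  fixes p :: "'s::finite"
  assumes "\<bar>k\<bar> = 1"
  shows "(\<lambda>a. if a = p then of_int k * sqrt (real CARD('s) - 1) else 1) \<in> star_eigenfunctions p k"
proof -
  have "sqrt (real CARD('s) - 1) * sqrt (real CARD('s) - 1) = real CARD('s) - 1"
    by (simp add: Suc_leI)
  moreover have "k = 1 \<or> k = -1" using assms by linarith
  ultimately show ?thesis
    by (auto simp: star_eigenfunctions_def star_operator_eq sum_plus_indicator)
qed

lemma star_eigenfunction_zero:
  assumes "f p = 0" "(\<Sum>a\<in>UNIV. f a) = 0"
  shows "f \<in> star_eigenfunctions p 0"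
  using assms by (simp add: star_eigenfunctions_def star_operator_eq)

lemma star_eigenfunctions_scale:
  "f \<in> star_eigenfunctions p k \<Longrightarrow> (\<lambda>a. r * f a) \<in> star_eigenfunctions p k"
  by (simp add: star_eigenfunctions_def star_operator_def sum_distrib_left[symmetric])

text \<open>Completeness of the star eigenfunctions. Let \<open>e\<^sub>k\<close> be the eigenfunctions for \<open>k = \<plusminus>1\<close>
  that have the value \<open>1\<close> on the leaves. The delta function at the centre is a multiple of
  \<open>e\<^sub>1 - e\<^bsub>-1\<^esub>\<close>. The delta function at a leaf differs from its mean over the leaves by an
  eigenfunction for \<open>0\<close>, and that mean is a multiple of \<open>e\<^sub>1 + e\<^bsub>-1\<^esub>\<close>.\<close>

lemma delta_sum_star_eigenfunctions:
  fixes p b :: "'s::finite"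
  assumes "CARD('s) \<ge> 2"
  shows "\<exists>g. (\<forall>k\<in>{-1,0,1}. g k \<in> star_eigenfunctions p k) \<and>
    (\<forall>a. (if a = b then 1 else 0) = (\<Sum>k\<in>{-1,0,1}. g k a))"
proof -
  define m where "m = real CARD('s) - 1"
  let ?s = "sqrt m"
  have m: "m > 0" using assms by (simp add: m_def)
  define e where "e = (\<lambda>k a. if a = p then of_int k * ?s else (1::real))"
  have e: "(\<lambda>a. r * e k a) \<in> star_eigenfunctions p k" if "\<bar>k\<bar> = 1" for r k
    unfolding e_def m_def by (intro star_eigenfunctions_scale star_eigenfunction_sign that)
  show ?thesis
  proof (cases "b = p")
    case True
    define g where "g = (\<lambda>k::int. if k = 0 then \<lambda>a. 0 else (\<lambda>a. (of_int k / (2 * ?s)) * e k a))"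
    have "g k \<in> star_eigenfunctions p k" if "k \<in> {-1,0,1}" for k
      using that e[of k "of_int k / (2 * ?s)"] star_eigenfunction_zero[of "\<lambda>a. 0" p]
      by (auto simp: g_def)
    moreover have "(if a = b then 1 else 0) = (\<Sum>k\<in>{-1,0,1}. g k a)" for a
      using m True by (simp add: g_def e_def)
    ultimately show ?thesis by blast
  next
    case False
    define h where "h = (\<lambda>a. (if a = b then 1 else 0) - (if a = p then 0 else 1 / m))"
    define g where "g = (\<lambda>k::int. if k = 0 then h else (\<lambda>a. (1 / (2 * m)) * e k a))"
    have "h \<in> star_eigenfunctions p 0"
    proof (rule star_eigenfunction_zero)
      show "h p = 0" using False by (simp add: h_def)
      show "(\<Sum>a\<in>UNIV. h a) = 0"
        using m by (simp add: h_def sum_subtractf sum_plus_indicator m_def[symmetric])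
    qed
    then have "g k \<in> star_eigenfunctions p k" if "k \<in> {-1,0,1}" for k
      using that e[of k "1 / (2 * m)"] by (auto simp: g_def)
    moreover have "(if a = b then 1 else 0) = (\<Sum>k\<in>{-1,0,1}. g k a)" for a
      using m False by (simp add: g_def e_def h_def field_simps)
    ultimately show ?thesis by blast
  qed
qed

lemma abs_sum_le_card:
  fixes k :: "'d::finite \<Rightarrow> int"
  assumes "\<And>c. k c \<in> {-1, 0, 1}"
  shows "\<bar>\<Sum>c\<in>UNIV. k c\<bar> \<le> int CARD('d)"
proof -
  have "\<bar>\<Sum>c\<in>UNIV. k c\<bar> \<le> (\<Sum>c\<in>UNIV. \<bar>k c\<bar>)" by (rule sum_abs)
  also have "\<dots> \<le> (\<Sum>c\<in>(UNIV::'d set). 1)"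
  proof (rule sum_mono)
    show "\<bar>k c\<bar> \<le> 1" for c using assms[of c] by auto
  qed
  finally show ?thesis by simp
qed

text \<open>A delta function on the vertices is a product of delta functions of the coordinates. Decomposing
  each factor into star eigenfunctions and expanding the product gives a sum of product
  eigenvectors.\<close>

lemma span_product_eigenvectors:
  fixes x :: "('s::finite)^('d::finite)"
  assumes "CARD('s) \<ge> 2"
  shows "span (\<Union>\<kappa>\<in>{-int CARD('d)..int CARD('d)}. product_eigenvectors x \<kappa>) = UNIV"
    (is "span ?U = UNIV")
proof -
  have "axis y 1 \<in> span ?U" for y :: "'s^'d"
  proof -
    have "\<forall>c. \<exists>g. (\<forall>k\<in>{-1,0,1}. g k \<in> star_eigenfunctions (x $ c) k) \<and>
        (\<forall>a. (if a = y $ c then 1 else 0) = (\<Sum>k\<in>{-1,0,1}. g k a))"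
      by (intro allI delta_sum_star_eigenfunctions[OF assms])
    from choice[OF this] obtain g
      where g: "\<And>c k. k \<in> {-1,0,1} \<Longrightarrow> g c k \<in> star_eigenfunctions (x $ c) k"
        "\<And>c a. (if a = y $ c then 1 else 0) = (\<Sum>k\<in>{-1,0,1}. g c k a)"
      by blast
    let ?K = "UNIV \<rightarrow>\<^sub>E {-1,0,1::int} :: ('d \<Rightarrow> int) set"
    have "axis y 1 $ z = (\<Sum>k\<in>?K. product_vector (\<lambda>c. g c (k c))) $ z" for z
    proof -
      have "axis y 1 $ z = (\<Prod>c\<in>UNIV. if z $ c = y $ c then 1 else 0 :: real)"
      proof (cases "z = y")
        case False
        then obtain c where "z $ c \<noteq> y $ c" by (auto simp: vec_eq_iff)
        then have "(\<Prod>c\<in>UNIV. if z $ c = y $ c then 1 else 0 :: real) = 0"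
          by (intro prod_zero) auto
        then show ?thesis using False by (simp add: axis_def)
      qed (simp add: axis_def)
      also have "\<dots> = (\<Prod>c\<in>UNIV. \<Sum>k\<in>{-1,0,1}. g c k (z $ c))"
        by (simp only: g(2))
      also have "\<dots> = (\<Sum>k\<in>?K. \<Prod>c\<in>UNIV. g c (k c) (z $ c))"
        by (rule prod_sum_PiE) auto
      finally show ?thesis by (simp add: product_vector_def)
    qed
    then have "axis y 1 = (\<Sum>k\<in>?K. product_vector (\<lambda>c. g c (k c)))"
      by (simp add: vec_eq_iff)
    also have "\<dots> \<in> span ?U"
    proof (intro span_sum span_base)
      fix k assume "k \<in> ?K"
      then have k: "k c \<in> {-1,0,1}" for c by (auto simp: PiE_def Pi_def)
      then have "product_vector (\<lambda>c. g c (k c)) \<in> product_eigenvectors x (\<Sum>c\<in>UNIV. k c)"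
        unfolding product_eigenvectors_def using g(1) by blast
      then show "product_vector (\<lambda>c. g c (k c)) \<in> ?U"
        using abs_sum_le_card[of k, OF k] by (intro UN_I[of "\<Sum>c\<in>UNIV. k c"]) auto
    qed
    finally show ?thesis .
  qed
  then have "(\<Sum>y\<in>UNIV. v $ y *\<^sub>R axis y 1) \<in> span ?U" for v :: "real^('s^'d)"
    by (intro span_sum span_scale)
  then have "v \<in> span ?U" for v
    by (metis (no_types) basis_expansion[of v, unfolded scalar_mult_eq_scaleR])
  then show ?thesis by auto
qed

text \<open>Two different leaves are required: for \<open>k = 0\<close>, the function is the difference of their delta
  functions.\<close>

lemma star_eigenfunction_nonzero:
  fixes p :: "'s::finite"
  assumes "CARD('s) \<ge> 3" "k \<in> {-1, 0, 1}"
  shows "\<exists>f \<in> star_eigenfunctions p k. \<exists>a. f a \<noteq> 0"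
proof -
  have "2 \<le> card (UNIV - {p})" using assms(1) by (simp add: card_Diff_singleton)
  from obtain_subset_with_card_n[OF this] obtain C where C: "C \<subseteq> UNIV - {p}" "card C = 2"
    by metis
  then obtain b b' where "C = {b, b'}" and neq: "b \<noteq> b'"
    by (meson card_2_iff)
  then have b: "b \<noteq> p" "b' \<noteq> p" using C(1) by auto
  show ?thesis
  proof (cases "k = 0")
    case True
    define f where "f = (\<lambda>a. (if a = b then 1 else 0) - (if a = b' then 1 else 0) :: real)"
    have "f \<in> star_eigenfunctions p 0"
    proof (rule star_eigenfunction_zero)
      show "f p = 0" using b by (simp add: f_def)
      show "(\<Sum>a\<in>UNIV. f a) = 0" unfolding f_def sum_subtractf by simp
    qed
    moreover have "f b \<noteq> 0" using neq by (simp add: f_def)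
    ultimately show ?thesis using True by metis
  next
    case False
    then have "\<bar>k\<bar> = 1" using assms(2) by auto
    from star_eigenfunction_sign[OF this, of p] show ?thesis
      by (rule bexI[rotated]) (use b(1) in \<open>auto intro!: exI[of _ b]\<close>)
  qed
qed

text \<open>To reach \<open>\<kappa>\<close>, take \<open>k\<^sub>c = sgn \<kappa>\<close> at \<open>\<bar>\<kappa>\<bar>\<close> coordinates and \<open>k\<^sub>c = 0\<close> at the others.\<close>

lemma product_eigenvectors_nonzero:
  fixes x :: "('s::finite)^('d::finite)"
  assumes "CARD('s) \<ge> 3" "\<bar>\<kappa>\<bar> \<le> int CARD('d)"
  shows "\<exists>v \<in> product_eigenvectors x \<kappa>. v \<noteq> 0"
proof -
  obtain C :: "'d set" where C: "card C = nat \<bar>\<kappa>\<bar>"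
    using assms(2) obtain_subset_with_card_n[of "nat \<bar>\<kappa>\<bar>" "UNIV :: 'd set"] by (auto simp: nat_le_iff)
  define k where "k = (\<lambda>c. if c \<in> C then sgn \<kappa> else 0)"
  have k: "k c \<in> {-1, 0, 1}" for c by (auto simp: k_def sgn_if)
  have "(\<Sum>c\<in>UNIV. k c) = int (card C) * sgn \<kappa>"
    by (simp add: k_def sum.If_cases)
  then have sum: "(\<Sum>c\<in>UNIV. k c) = \<kappa>" by (simp add: C abs_mult_sgn)
  obtain f a where f: "\<And>c. f c \<in> star_eigenfunctions (x $ c) (k c)" "\<And>c. f c (a c) \<noteq> 0"
  proof -
    have "\<exists>f a. f \<in> star_eigenfunctions (x $ c) (k c) \<and> f a \<noteq> 0" for c
      using star_eigenfunction_nonzero[OF assms(1) k] by blast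
    then show thesis using that by metis
  qed
  have "product_vector f $ (\<chi> c. a c) \<noteq> 0"
    using f(2) by (simp add: product_vector_def)
  then have "product_vector f \<noteq> 0" by auto
  moreover have "product_vector f \<in> product_eigenvectors x \<kappa>"
    unfolding product_eigenvectors_def using f(1) k sum by blast
  ultimately show ?thesis by blast
qed

section \<open>The action of the dual adjacency matrix\<close>

text \<open>A star is bipartite with its centre as one of the two parts, so the sign change at the centre
  anticommutes with its adjacency operator.\<close>

lemma star_eigenfunctions_flip:
  assumes "f \<in> star_eigenfunctions p k"
  shows "(\<lambda>a. if a = p then - f a else f a) \<in> star_eigenfunctions p (- k)"
proof -
  let ?f = "\<lambda>a. if a = p then - f a else f a"
  have "star_operator p ?f b = (if b = p then 1 else -1) * star_operator p f b" for b
    by (auto simp: star_operator_def sum_negf[symmetric] intro!: sum.cong)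
  then show ?thesis using assms by (auto simp: star_eigenfunctions_def)
qed

lemma product_eigenvectors_flip:
  assumes "v \<in> product_eigenvectors x \<kappa>"
  shows "\<exists>j \<in> {-1, 0, 1}. (\<chi> y. if y $ c = x $ c then - v $ y else v $ y) \<in> product_eigenvectors x (\<kappa> + 2 * j)"
proof -
  obtain f k where v: "v = product_vector f" and \<kappa>: "(\<Sum>c\<in>UNIV. k c) = \<kappa>"
    and f: "\<And>c. f c \<in> star_eigenfunctions (x $ c) (k c)" and k: "\<And>c. k c \<in> {-1, 0, 1}"
    using assms unfolding product_eigenvectors_def by blast
  define f' where "f' = f(c := \<lambda>a. if a = x $ c then - f c a else f c a)"
  have "f' j \<in> star_eigenfunctions (x $ j) ((k(c := - k c)) j)" for j
    using f star_eigenfunctions_flip[OF f] by (simp add: f'_def)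
  moreover have "(k(c := - k c)) j \<in> {-1, 0, 1}" for j using k[of j] by auto
  moreover have "(\<Sum>j\<in>UNIV. (k(c := - k c)) j) = \<kappa> + 2 * (- k c)"
    unfolding \<kappa>[symmetric] sum.remove[OF finite UNIV_I, of _ c] by simp
  ultimately have "product_vector f' \<in> product_eigenvectors x (\<kappa> + 2 * (- k c))"
    unfolding product_eigenvectors_def by blast
  moreover have "product_vector f' = (\<chi> y. if y $ c = x $ c then - v $ y else v $ y)"
    unfolding v by (simp add: vec_eq_iff product_vector_nth_remove[of _ _ c] f'_def)
  moreover have "- k c \<in> {-1, 0, 1}" using k[of c] by auto
  ultimately show ?thesis by metis
qed

text \<open>The summands are ordered by increasing index \<open>i = D - \<kappa>\<close> of the eigenvalue \<open>\<theta>\<^sub>i\<close>.\<close>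

definition eigenspace_triple :: "('s::finite)^('d::finite) \<Rightarrow> int \<Rightarrow> (real^('s^'d)) set"
  where "eigenspace_triple x \<kappa> =
    (let W = (\<lambda>j. eigenspace (adjacency_matrix (full_bipartite_graph hamming_graph x))
                    (sqrt (real CARD('s) - 1) * of_int j))
     in W (\<kappa> + 2) + W \<kappa> + W (\<kappa> - 2))"

lemma subspace_eigenspace_triple: "subspace (eigenspace_triple x \<kappa>)"
proof -
  have plus: "subspace (U + V)" if "subspace U" "subspace V" for U V :: "(real^('a^'b)) set"
  proof -
    have "U + V = {u + v | u v. u \<in> U \<and> v \<in> V}" by (auto simp: set_plus_def)
    then show ?thesis using subspace_sums[OF that] by simp
  qed
  show ?thesis
    unfolding eigenspace_triple_def Let_def by (intro plus subspace_eigenspace)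
qed

lemma product_eigenvectors_in_triple:
  assumes "v \<in> product_eigenvectors x (\<kappa> + 2 * j)" "j \<in> {-1, 0, 1}"
  shows "v \<in> eigenspace_triple x \<kappa>"
proof -
  let ?W = "\<lambda>j. eigenspace (adjacency_matrix (full_bipartite_graph hamming_graph x))
                    (sqrt (real CARD('a) - 1) * of_int j)"
  have v: "v \<in> ?W (\<kappa> + 2 * j)" using assms(1) product_eigenvectors_subset_eigenspace by blast
  have z: "0 \<in> ?W i" for i by (rule subspace_0[OF subspace_eigenspace])
  have I: "u + v + w \<in> eigenspace_triple x \<kappa>"
    if "u \<in> ?W (\<kappa> + 2)" "v \<in> ?W \<kappa>" "w \<in> ?W (\<kappa> - 2)" for u v w
    using that unfolding eigenspace_triple_def Let_def by (intro set_plus_intro)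
  consider "j = 1" | "j = 0" | "j = -1" using assms(2) by auto
  then show ?thesis
  proof cases
    case 1
    then show ?thesis using v I[of v 0 0] z[of \<kappa>] z[of "\<kappa> - 2"] by simp
  next
    case 2
    then show ?thesis using v I[of 0 v 0] z[of "\<kappa> + 2"] z[of "\<kappa> - 2"] by simp
  next
    case 3
    then show ?thesis using v I[of 0 0 v] z[of \<kappa>] z[of "\<kappa> + 2"] by simp
  qed
qed

text \<open>The distance from \<open>x\<close> counts the coordinates with \<open>y\<^sub>c \<noteq> x\<^sub>c\<close>, and the indicator of this
  condition is the mean of the identity and the sign change at \<open>x\<^sub>c\<close>.\<close>

lemma dual_adjacency_on_product_eigenvectors:
  fixes x :: "('s::finite)^('d::finite)"
  assumes "v \<in> product_eigenvectors x \<kappa>"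
  shows "diagonal_matrix (\<lambda>y. \<alpha> - \<beta> * real (hamming_dist x y)) *v v \<in> eigenspace_triple x \<kappa>"
proof -
  define flip where "flip = (\<lambda>c. \<chi> y. if y $ c = x $ c then - v $ y else v $ y)"
  \<comment> \<open>\<open>v + flip c\<close> is \<open>2 v\<close> where \<open>y\<^sub>c \<noteq> x\<^sub>c\<close> and \<open>0\<close> elsewhere.\<close>
  have wt: "real (hamming_dist x y) * v $ y = (\<Sum>c\<in>UNIV. (v $ y + flip c $ y) / 2)" for y
  proof -
    have "real (hamming_dist x y) = (\<Sum>c\<in>UNIV. if y $ c \<noteq> x $ c then 1 else 0)"
      by (simp add: hamming_dist_def sum.If_cases)
    then show ?thesis
      by (auto simp: sum_distrib_right flip_def intro!: sum.cong)
  qed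
  have "diagonal_matrix (\<lambda>y. \<alpha> - \<beta> * real (hamming_dist x y)) *v v =
      \<alpha> *\<^sub>R v - \<beta> *\<^sub>R (\<Sum>c\<in>UNIV. (1/2) *\<^sub>R (v + flip c))"
    using wt by (simp add: vec_eq_iff diagonal_matrix_mult_vector left_diff_distrib mult.assoc
        add_divide_distrib)
  also have "\<dots> \<in> eigenspace_triple x \<kappa>"
  proof -
    note S = subspace_eigenspace_triple[of x \<kappa>]
    have "v \<in> eigenspace_triple x \<kappa>"
      using product_eigenvectors_in_triple[of v x \<kappa> 0] assms by simp
    moreover have "flip c \<in> eigenspace_triple x \<kappa>" for c
      using product_eigenvectors_flip[OF assms, of c] product_eigenvectors_in_triple
      unfolding flip_def by blast
    ultimately show ?thesis
      by (intro subspace_diff[OF S] subspace_scale[OF S] subspace_sum[OF S] subspace_add[OF S])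
  qed
  finally show ?thesis .
qed

text \<open>The eigenspace is spanned by the product eigenvectors it contains: the projection onto it fixes
  these and annihilates all others. So it suffices to follow the projected product eigenvectors.\<close>

lemma dual_adjacency_on_eigenspace:
  fixes x :: "('s::finite)^('d::finite)"
  assumes s: "CARD('s) \<ge> 2"
    and v: "v \<in> eigenspace (adjacency_matrix (full_bipartite_graph hamming_graph x))
      (sqrt (real CARD('s) - 1) * of_int \<kappa>)"
  shows "diagonal_matrix (\<lambda>y. \<alpha> - \<beta> * real (hamming_dist x y)) *v v \<in> eigenspace_triple x \<kappa>"
proof -
  let ?A = "adjacency_matrix (full_bipartite_graph hamming_graph x)"
  let ?B = "diagonal_matrix (\<lambda>y. \<alpha> - \<beta> * real (hamming_dist x y))"
  define \<theta> where "\<theta> = (\<lambda>j::int. sqrt (real CARD('s) - 1) * of_int j)"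
  let ?I = "{-int CARD('d)..int CARD('d)}"
  have inj: "\<theta> i = \<theta> j \<longleftrightarrow> i = j" for i j using s by (simp add: \<theta>_def)
  have "finite (\<theta> ` (?I - {\<kappa>}))" by simp
  moreover have "\<theta> \<kappa> \<notin> \<theta> ` (?I - {\<kappa>})"
    by (auto simp: inj)
  ultimately obtain P where P: "\<And>v. v \<in> eigenspace ?A (\<theta> \<kappa>) \<Longrightarrow> P *v v = v"
    "\<And>\<mu> v. \<mu> \<in> \<theta> ` (?I - {\<kappa>}) \<Longrightarrow> v \<in> eigenspace ?A \<mu> \<Longrightarrow> P *v v = 0"
    by (rule interpolating_projection[of _ _ ?A]) blast
  note S = subspace_eigenspace_triple[of x \<kappa>]
  have "span (\<Union>\<kappa>\<in>?I. product_eigenvectors x \<kappa>) \<subseteq> {u. ?B *v (P *v u) \<in> eigenspace_triple x \<kappa>}"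
  proof (intro span_minimal subsetI)
    show "subspace {u. ?B *v (P *v u) \<in> eigenspace_triple x \<kappa>}"
      using S by (auto simp: subspace_def matrix_vector_right_distrib matrix_vector_mult_scaleR)
    fix u assume "u \<in> (\<Union>\<kappa>\<in>?I. product_eigenvectors x \<kappa>)"
    then obtain j where j: "j \<in> ?I" "u \<in> product_eigenvectors x j" by blast
    then have "u \<in> eigenspace ?A (\<theta> j)"
      using product_eigenvectors_subset_eigenspace unfolding \<theta>_def by blast
    then have "P *v u = (if j = \<kappa> then u else 0)" using P(1)[of u] P(2)[of "\<theta> j" u] j(1) by (cases "j = \<kappa>") auto
    then show "u \<in> {u. ?B *v (P *v u) \<in> eigenspace_triple x \<kappa>}"
      using dual_adjacency_on_product_eigenvectors[of u x \<kappa>] j(2) subspace_0[OF S] by auto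
  qed
  then have "?B *v (P *v v) \<in> eigenspace_triple x \<kappa>"
    using span_product_eigenvectors[OF s, of x] by auto
  then show ?thesis using P(1)[of v] v by (simp add: \<theta>_def)
qed

text \<open>The ordering enters only through the rule that the indices \<open>i - 2\<close> and \<open>i + 2\<close>, when they occur
  at all, are the immediate predecessor and successor of \<open>i\<close>. When they do not occur, their
  eigenspaces are trivial.\<close>

lemma is_dual_adjacency_matrix_for_ordering:
  fixes x :: "('s::finite)^('d::finite)" and E :: "nat \<Rightarrow> real^('s^'d)^('s^'d)"
  defines "\<Gamma> \<equiv> full_bipartite_graph hamming_graph x"
  assumes n: "CARD('s) \<ge> 3"
    and E: "\<And>i. i \<le> 2 * CARD('d) \<Longrightarrow> E i = primitive_idempotent (adjacency_matrix \<Gamma>)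
      (sqrt (real CARD('s) - 1) * of_int (int CARD('d) - int i))"
    and idx: "distinct idx" "set idx = {0..2 * CARD('d)}"
    and prev: "\<And>m. m < length idx \<Longrightarrow> 2 \<le> idx ! m \<Longrightarrow> 0 < m \<and> idx ! (m - 1) = idx ! m - 2"
    and succ: "\<And>m. m < length idx \<Longrightarrow> idx ! m + 2 \<le> 2 * CARD('d) \<Longrightarrow>
      Suc m < length idx \<and> idx ! Suc m = idx ! m + 2"
    and \<beta>: "\<beta> \<noteq> 0"
  shows "is_dual_adjacency_matrix \<Gamma> x CARD('d) (map E idx)
    (diagonal_matrix (\<lambda>y. \<alpha> - \<beta> * real (hamming_dist x y)))"
proof -
  let ?A = "adjacency_matrix \<Gamma>"
  let ?B = "diagonal_matrix (\<lambda>y. \<alpha> - \<beta> * real (hamming_dist x y))"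
  let ?D = "CARD('d)"
  define \<theta> where "\<theta> = (\<lambda>j::int. sqrt (real CARD('s) - 1) * of_int j)"
  let ?I = "{-int ?D..int ?D}"
  have inj: "\<theta> i = \<theta> j \<longleftrightarrow> i = j" for i j using n by (auto simp: \<theta>_def)
  have sub: "product_eigenvectors x \<kappa> \<subseteq> eigenspace ?A (\<theta> \<kappa>)" for \<kappa>
    unfolding \<Gamma>_def \<theta>_def by (rule product_eigenvectors_subset_eigenspace)
  have "UNIV = span (\<Union>\<kappa>\<in>?I. product_eigenvectors x \<kappa>)"
    using span_product_eigenvectors[of x] n by simp
  also have "\<dots> \<subseteq> span (\<Union>\<mu>\<in>\<theta> ` ?I. eigenspace ?A \<mu>)"
    using sub by (intro span_mono) blast
  finally have span: "span (\<Union>\<mu>\<in>\<theta> ` ?I. eigenspace ?A \<mu>) = UNIV" by blast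
  have fin: "finite (\<theta> ` ?I)" by simp
  have ev: "eigenvalues ?A = \<theta> ` ?I"
  proof
    show "eigenvalues ?A \<subseteq> \<theta> ` ?I"
      using eigenspace_trivial[OF fin span] by (fastforce simp: eigenvalues_def eigenspace_def)
    show "\<theta> ` ?I \<subseteq> eigenvalues ?A"
    proof clarify
      fix \<kappa> assume "\<kappa> \<in> ?I"
      then obtain v where "v \<in> product_eigenvectors x \<kappa>" "v \<noteq> 0"
        using product_eigenvectors_nonzero[OF n, of \<kappa> x] by (auto simp: abs_le_iff)
      then show "\<theta> \<kappa> \<in> eigenvalues ?A"
        using sub[of \<kappa>] by (auto simp: eigenvalues_def eigenspace_def)
    qed
  qed
  have E': "E i = primitive_idempotent ?A (\<theta> (int ?D - int i))" if "i \<le> 2 * ?D" for i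
    using E[OF that] by (simp add: \<theta>_def)
  have I: "(\<lambda>i. int ?D - int i) ` {0..2 * ?D} = ?I"
  proof (intro equalityI subsetI)
    fix \<kappa> assume "\<kappa> \<in> ?I"
    then show "\<kappa> \<in> (\<lambda>i. int ?D - int i) ` {0..2 * ?D}"
      by (intro image_eqI[of _ _ "nat (int ?D - \<kappa>)"]) auto
  qed auto
  have "inj_on E {0..2 * ?D}"
  proof (rule inj_onI)
    fix i j assume ij: "i \<in> {0..2 * ?D}" "j \<in> {0..2 * ?D}" "E i = E j"
    then have "\<theta> (int ?D - int i) = \<theta> (int ?D - int j)"
      using E' ev I by (intro inj_onD[OF inj_on_primitive_idempotent[OF fin span]]) auto
    then show "i = j" by (simp add: inj)
  qed
  moreover have "E ` {0..2 * ?D} = primitive_idempotents ?A"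
  proof -
    have "E ` {0..2 * ?D} = (\<lambda>i. primitive_idempotent ?A (\<theta> (int ?D - int i))) ` {0..2 * ?D}"
      using E' by (intro image_cong) auto
    also have "\<dots> = primitive_idempotent ?A ` \<theta> ` (\<lambda>i. int ?D - int i) ` {0..2 * ?D}"
      by (simp add: image_image)
    finally show ?thesis unfolding I ev[symmetric] primitive_idempotents_def .
  qed
  ultimately have "is_idempotent_ordering ?A (map E idx)"
    using idx by (simp add: is_idempotent_ordering_def distinct_map)
  moreover have "generated_subalgebra ?B = dual_adjacency_algebra \<Gamma> x ?D"
  proof -
    have dist: "graph_dist \<Gamma> x y = hamming_dist x y" for y
      by (simp add: \<Gamma>_def graph_dist_full_bipartite)
    have "hamming_dist x y \<le> ?D" for y by (simp add: hamming_dist_def card_mono)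
    then show ?thesis
      using generated_subalgebra_radial_diagonal[of \<Gamma> x ?D "\<lambda>i. \<alpha> - \<beta> * real i"] \<beta>
      by (simp add: dist inj_on_def)
  qed
  moreover have "(\<lambda>v. ?B *v v) ` column_image (idempotent_at (map E idx) i) \<subseteq>
         column_image (idempotent_at (map E idx) (i - 1)) + column_image (idempotent_at (map E idx) i)
         + column_image (idempotent_at (map E idx) (i + 1))"
    if i: "i \<in> {0..<int (length (map E idx))}" for i
  proof -
    define m where "m = nat i"
    have m: "m < length idx" "i = int m" using i by (auto simp: m_def)
    have idx_le: "idx ! l \<le> 2 * ?D" if "l < length idx" for l
      using idx(2) that by (metis atLeastAtMost_iff nth_mem)
    define \<kappa> where "\<kappa> = int ?D - int (idx ! m)"
    have col: "column_image (idempotent_at (map E idx) (int l)) = eigenspace ?A (\<theta> (int ?D - int (idx ! l)))"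
      if "l < length idx" for l
      using that E'[OF idx_le[OF that]]
      by (simp add: idempotent_at_def column_image_primitive_idempotent[OF fin span])
    have zero: "0 \<in> column_image P" for P :: "real^('s^'d)^('s^'d)"
      unfolding column_image_def by (metis matrix_vector_mult_0_right rangeI)
    have triv: "eigenspace ?A (\<theta> j) = {0}" if "j \<notin> ?I" for j
      using that inj by (intro eigenspace_trivial[OF fin span]) auto
    have B: "?B *v v \<in> eigenspace_triple x \<kappa>" if "v \<in> eigenspace ?A (\<theta> \<kappa>)" for v
      using dual_adjacency_on_eigenspace[of v x \<kappa>] that n by (simp add: \<Gamma>_def \<theta>_def)
    have "eigenspace ?A (\<theta> (\<kappa> + 2)) \<subseteq> column_image (idempotent_at (map E idx) (i - 1))"
    proof (cases "2 \<le> idx ! m")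
      case True
      then have "0 < m" "idx ! (m - 1) = idx ! m - 2" using prev[OF m(1)] by auto
      then show ?thesis using True col[of "m - 1"] m by (simp add: \<kappa>_def of_nat_diff algebra_simps)
    next
      case False
      then show ?thesis using triv[of "\<kappa> + 2"] zero by (simp add: \<kappa>_def)
    qed
    moreover have col_i: "eigenspace ?A (\<theta> \<kappa>) = column_image (idempotent_at (map E idx) i)"
      using col[OF m(1)] m(2) by (simp add: \<kappa>_def)
    moreover have "eigenspace ?A (\<theta> (\<kappa> - 2)) \<subseteq> column_image (idempotent_at (map E idx) (i + 1))"
    proof (cases "idx ! m + 2 \<le> 2 * ?D")
      case True
      then have "Suc m < length idx" "idx ! Suc m = idx ! m + 2" using succ[OF m(1)] by auto
      then show ?thesis using col[of "Suc m"] m(2) by (simp add: \<kappa>_def algebra_simps)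
    next
      case False
      then show ?thesis using triv[of "\<kappa> - 2"] zero by (simp add: \<kappa>_def)
    qed
    moreover have "eigenspace_triple x \<kappa> =
        eigenspace ?A (\<theta> (\<kappa> + 2)) + eigenspace ?A (\<theta> \<kappa>) + eigenspace ?A (\<theta> (\<kappa> - 2))"
      by (simp add: eigenspace_triple_def Let_def \<theta>_def \<Gamma>_def)
    ultimately have "eigenspace_triple x \<kappa> \<subseteq> column_image (idempotent_at (map E idx) (i - 1)) +
        column_image (idempotent_at (map E idx) i) + column_image (idempotent_at (map E idx) (i + 1))"
      by (simp add: set_plus_mono2)
    then show ?thesis using col_i B by blast
  qed
  ultimately show ?thesis by (simp add: is_dual_adjacency_matrix_def)
qed

theorem theorem7p3:
  fixes D n :: nat
    and x :: "('s::finite)^('d::finite)"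
    and \<Gamma> :: "'s^'d \<Rightarrow> 's^'d \<Rightarrow> bool"
    and A Astar :: "real^('s^'d)^('s^'d)"
    and \<theta> :: "nat \<Rightarrow> real"
    and E :: "nat \<Rightarrow> real^('s^'d)^('s^'d)"
  assumes "CARD('d) = D" and "CARD('s) = n" and "D \<ge> 3" and "n \<ge> 3"
    and "\<Gamma> = full_bipartite_graph hamming_graph x"
    and "A = adjacency_matrix \<Gamma>"
    and "Astar = diagonal_matrix
           (\<lambda>y. real D * (real n - 1) - real n * real (graph_dist hamming_graph x y))"
    and "\<And>i. \<theta> i = sqrt (real n - 1) * (real D - real i)"
    and "\<And>i. i \<le> 2 * D \<Longrightarrow> E i = primitive_idempotent A (\<theta> i)"
  shows "is_dual_adjacency_matrix \<Gamma> x D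
           (map (\<lambda>j. E (2 * j)) [0..<D + 1] @ map (\<lambda>j. E (2 * j + 1)) [0..<D]) Astar \<and>
         is_dual_adjacency_matrix \<Gamma> x D
           (map (\<lambda>j. E (2 * j + 1)) [0..<D] @ map (\<lambda>j. E (2 * j)) [0..<D + 1]) Astar"
proof -
  let ?ev = "map (\<lambda>j. 2 * j) [0..<D + 1]" and ?od = "map (\<lambda>j. 2 * j + 1) [0..<D]"
  have set: "set (?ev @ ?od) = {0..2 * D}"
  proof (intro equalityI subsetI)
    fix i assume "i \<in> {0..2 * D}"
    then show "i \<in> set (?ev @ ?od)"
      by (cases "even i") (auto elim!: evenE oddE)
  qed auto
  have dist: "distinct (?ev @ ?od)"
  proof -
    have "2 * a \<noteq> Suc (2 * b)" for a b :: nat by presburger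
    then show ?thesis by (auto simp: distinct_map inj_on_def)
  qed
  have Astar: "Astar = diagonal_matrix (\<lambda>y. real D * (real n - 1) - real n * real (hamming_dist x y))"
    by (simp add: assms(7) graph_dist_hamming)
  have dual: "is_dual_adjacency_matrix \<Gamma> x D (map E idx) Astar"
    if "distinct idx" "set idx = {0..2 * D}"
      "\<And>m. m < length idx \<Longrightarrow> 2 \<le> idx ! m \<Longrightarrow> 0 < m \<and> idx ! (m - 1) = idx ! m - 2"
      "\<And>m. m < length idx \<Longrightarrow> idx ! m + 2 \<le> 2 * D \<Longrightarrow>
         Suc m < length idx \<and> idx ! Suc m = idx ! m + 2" for idx
    using is_dual_adjacency_matrix_for_ordering[of E x idx "real n" "real D * (real n - 1)"] that assms
    unfolding Astar by simp
  have "is_dual_adjacency_matrix \<Gamma> x D (map E (?ev @ ?od)) Astar"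
  proof (rule dual[OF dist set])
    fix m assume m: "m < length (?ev @ ?od)"
    show "0 < m \<and> (?ev @ ?od) ! (m - 1) = (?ev @ ?od) ! m - 2" if "2 \<le> (?ev @ ?od) ! m"
      using m that by (auto simp: nth_append simp del: upt_Suc split: if_splits)
    show "Suc m < length (?ev @ ?od) \<and> (?ev @ ?od) ! Suc m = (?ev @ ?od) ! m + 2"
      if "(?ev @ ?od) ! m + 2 \<le> 2 * D"
      using m that by (auto simp: nth_append simp del: upt_Suc split: if_splits)
  qed
  moreover have "is_dual_adjacency_matrix \<Gamma> x D (map E (?od @ ?ev)) Astar"
  proof (rule dual)
    show "distinct (?od @ ?ev)" "set (?od @ ?ev) = {0..2 * D}"
      using dist set by auto
    fix m assume m: "m < length (?od @ ?ev)"
    show "0 < m \<and> (?od @ ?ev) ! (m - 1) = (?od @ ?ev) ! m - 2" if "2 \<le> (?od @ ?ev) ! m"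
      using m that by (auto simp: nth_append simp del: upt_Suc split: if_splits)
    show "Suc m < length (?od @ ?ev) \<and> (?od @ ?ev) ! Suc m = (?od @ ?ev) ! m + 2"
      if "(?od @ ?ev) ! m + 2 \<le> 2 * D"
      using m that by (auto simp: nth_append simp del: upt_Suc split: if_splits)
  qed
  ultimately show ?thesis by (simp add: o_def del: upt_Suc)
qed

end
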